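(* Let $A\in\mathbb{R}^{m\times n}$ have full row rank, $b\in\mathbb{R}^m$, $\sigma>0$, and consider the problem $$\min_{x\in\mathbb{R}^n}\ \frac{\|x\|_1}{\|x\|}\quad\text{subject to}\quad q(x)\le0,$$ where $q$ is one of the following: (a) $q(x)=\|Ax-b\|^2-\sigma^2$, with $\|b\|>\sigma$; or (b) $q(x)=\|Ax-b\|_{LL_2,\gamma}-\sigma$ for some $\gamma>0$, with $\|b\|_{LL_2,\gamma}>\sigma$. Suppose that $\ker A$ has the $s$-spherical section property and there exists $\widetilde x\in\mathbb{R}^n$ such that $\|\widetilde x\|_0<m/s$ and $q(\widetilde x)\le0$. Then the optimal value of the problem is attained.
   Context: $\|\cdot\|$ is the Euclidean norm, $\|\cdot\|_1$ the $\ell_1$ norm, and $\|x\|_0$ the number of nonzero entries of $x$. The Lorentzian norm is $\|y\|_{LL_2,\gamma}:=\sum_{i=1}^m\log(1+\gamma^{-2}y_i^2)$ for $y\in\mathbb{R}^m$. Note $q(0)>0$ in both cases, so feasible points are nonzero. Spherical section property: let $m<n$ be positive integers, let $V$ be an $(n-m)$-dimensional subspace of $\mathbb{R}^n$ and let $s$ be a positive integer. $V$ has the $s$-spherical section property if $\inf_{v\in V\setminus\{0\}}\frac{\|v\|_1}{\|v\|}\ge\sqrt{m/s}$. (Thus, when this property is invoked for $\ker A$, it is understood that $m<n$ and $s$ is a positive integer.) *)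

theory Defs
  imports "HOL-Analysis.Analysis"
begin

definition l1_norm :: "real ^ 'n \<Rightarrow> real" where
  "l1_norm x = (\<Sum>i\<in>UNIV. \<bar>x $ i\<bar>)"

definition l0_norm :: "real ^ 'n \<Rightarrow> nat" where
  "l0_norm x = card {i. x $ i \<noteq> 0}"

(* The logarithm is the natural one. *)
definition lorentzian_norm :: "real \<Rightarrow> real ^ 'm \<Rightarrow> real" where
  "lorentzian_norm \<gamma> y = (\<Sum>i\<in>UNIV. ln (1 + (y $ i)\<^sup>2 / \<gamma>\<^sup>2))"

(* The standing conditions on m, s and V belong to the property. They give dim V > 0, so the
   infimum is over a nonempty set of reals that is bounded below by 0. *)
definition spherical_section_property :: "nat \<Rightarrow> nat \<Rightarrow> (real ^ 'n) set \<Rightarrow> bool" where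
  "spherical_section_property m s V \<longleftrightarrow>
     0 < m \<and> m < CARD('n) \<and> 0 < s \<and> subspace V \<and> dim V = CARD('n) - m \<and>
     (INF v\<in>V - {0}. l1_norm v / norm v) \<ge> sqrt (real m / real s)"

end

theory Submission
  imports Defs
begin

text \<open>
  The objective is constant along rays, so its sublevel sets are cones and a minimising sequence
  could escape to infinity. If it did, its directions would accumulate at a unit vector \<open>d\<close>;
  feasibility keeps \<open>A x - b\<close> bounded, hence \<open>A d = 0\<close>. But on the kernel the objective is at
  least \<open>sqrt (m / s)\<close>, whereas the sparse feasible point has objective value at most
  \<open>sqrt (l0_norm xt) < sqrt (m / s)\<close> by Cauchy-Schwarz, so directions of competitive points
  stay away from the kernel.

  This is used quantitatively. Let \<open>K\<close> be the cone of points whose objective does not exceed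
  \<open>c\<close>, the value at the sparse point. As \<open>K\<close> is closed and meets the kernel only in \<open>0\<close>,
  compactness of its unit vectors gives \<open>\<delta> > 0\<close> with \<open>\<delta> * norm x \<le> norm (A x)\<close>
  on \<open>K\<close> (\<open>injective_on_closed_cone_lower_bound\<close>). The feasible points of \<open>K\<close> therefore form a
  compact set, which omits \<open>0\<close> since \<open>q 0 > 0\<close>, so the objective is continuous on it and attains its
  minimum there (\<open>ratio_attains_min\<close>). The two constraint functions are treated alike: each is
  continuous, positive at \<open>0\<close>, and keeps \<open>A x\<close> bounded over the feasible set.
\<close>

lemma continuous_on_l1_norm [continuous_intros]:
  "continuous_on S f \<Longrightarrow> continuous_on S (\<lambda>x. l1_norm (f x))"
  unfolding l1_norm_def by (intro continuous_intros)

lemma l1_norm_scaleR: "l1_norm (r *\<^sub>R x) = \<bar>r\<bar> * l1_norm x"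
  by (simp add: l1_norm_def abs_mult sum_distrib_left)

lemma l1_norm_nonneg: "0 \<le> l1_norm x"
  by (simp add: l1_norm_def sum_nonneg)

text \<open>Cauchy-Schwarz against the indicator of the support.\<close>

lemma l1_norm_le_sqrt_l0_norm: "l1_norm x \<le> sqrt (real (l0_norm x)) * norm x"
proof -
  let ?S = "{i. x $ i \<noteq> 0}"
  have "l1_norm x = (\<Sum>i\<in>?S. \<bar>1\<bar> * \<bar>x $ i\<bar>)"
    unfolding l1_norm_def by (rule sum.mono_neutral_cong_right) auto
  also have "\<dots> \<le> L2_set (\<lambda>_. 1) ?S * L2_set (\<lambda>i. x $ i) ?S"
    by (rule L2_set_mult_ineq)
  also have "L2_set (\<lambda>i. x $ i) ?S = norm x"
    unfolding L2_set_def norm_vec_def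
    by (intro arg_cong[where f = sqrt] sum.mono_neutral_cong_left) auto
  also have "L2_set (\<lambda>_. 1) ?S = sqrt (real (l0_norm x))"
    by (simp add: L2_set_def l0_norm_def)
  finally show ?thesis .
qed

lemma spherical_section_property_lower_bound:
  assumes "spherical_section_property m s V" "v \<in> V" "v \<noteq> 0"
  shows "sqrt (real m / real s) \<le> l1_norm v / norm v"
proof -
  have "bdd_below ((\<lambda>v. l1_norm v / norm v) ` (V - {0}))"
    by (rule bdd_belowI[where m = 0]) (auto simp: l1_norm_nonneg)
  then have "(INF v\<in>V - {0}. l1_norm v / norm v) \<le> l1_norm v / norm v"
    using assms by (intro cINF_lower) auto
  then show ?thesis
    using assms(1) unfolding spherical_section_property_def by linarith
qed

text \<open>
  The unit vectors of \<open>K\<close> form a compact set on which \<open>norm (f x)\<close> is positive; its minimum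
  there is \<open>\<delta>\<close>, and homogeneity carries the bound to the whole cone.
\<close>

lemma injective_on_closed_cone_lower_bound:
  fixes f :: "'a::euclidean_space \<Rightarrow> 'b::real_normed_vector"
  assumes "linear f" "closed K"
    and cone: "\<And>x r. x \<in> K \<Longrightarrow> 0 \<le> r \<Longrightarrow> r *\<^sub>R x \<in> K"
    and inj: "\<And>x. x \<in> K \<Longrightarrow> f x = 0 \<Longrightarrow> x = 0"
  obtains \<delta> where "\<delta> > 0" "\<And>x. x \<in> K \<Longrightarrow> \<delta> * norm x \<le> norm (f x)"
proof (cases "K \<inter> sphere 0 1 = {}")
  case True
  have "x = 0" if "x \<in> K" for x
  proof (rule ccontr)
    assume "x \<noteq> 0"
    then have "inverse (norm x) *\<^sub>R x \<in> K \<inter> sphere 0 1"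
      using cone[OF that, of "inverse (norm x)"] by simp
    with True show False by blast
  qed
  then have "1 * norm x \<le> norm (f x)" if "x \<in> K" for x
    using that by force
  then show ?thesis by (intro that[of 1]) simp_all
next
  case False
  have "compact (K \<inter> sphere 0 1)"
    using \<open>closed K\<close> by (simp add: closed_Int_compact)
  moreover have "continuous_on (K \<inter> sphere 0 1) (\<lambda>x. norm (f x))"
    by (intro continuous_on_norm linear_continuous_on linear_conv_bounded_linear[THEN iffD1]
        \<open>linear f\<close>)
  ultimately obtain u where u: "u \<in> K \<inter> sphere 0 1"
    and min: "\<And>y. y \<in> K \<inter> sphere 0 1 \<Longrightarrow> norm (f u) \<le> norm (f y)"
    using continuous_attains_inf[OF _ False] by metis
  show ?thesis
  proof (rule that[of "norm (f u)"])
    show "norm (f u) > 0" using inj[of u] u by auto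
    show "norm (f u) * norm x \<le> norm (f x)" if "x \<in> K" for x
    proof (cases "x = 0")
      case False
      have "norm (f u) \<le> norm (f (inverse (norm x) *\<^sub>R x))"
        using False cone[OF that, of "inverse (norm x)"] by (intro min) simp
      also have "\<dots> = norm (f x) / norm x"
        by (simp add: linear_scale[OF \<open>linear f\<close>] divide_inverse_commute)
      finally show ?thesis using False by (simp add: field_simps)
    qed simp
  qed
qed

text \<open>
  Because the point \<open>z\<close> beats every kernel direction, the points at least as good as \<open>z\<close> are
  bounded by the bound \<open>B\<close> on \<open>norm (A x)\<close> divided by the constant \<open>\<delta>\<close> of the cone, and a minimiser
  over them is a global one.
\<close>

lemma ratio_attains_min:
  fixes A :: "real ^ 'n ^ 'm" and q :: "real ^ 'n \<Rightarrow> real"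
  assumes cont: "continuous_on UNIV q"
    and q0: "q 0 > 0"
    and bound: "\<And>x. q x \<le> 0 \<Longrightarrow> norm (A *v x) \<le> B"
    and feasible: "q z \<le> 0"
    and kernel: "\<And>v. A *v v = 0 \<Longrightarrow> v \<noteq> 0 \<Longrightarrow> l1_norm z / norm z < l1_norm v / norm v"
  shows "\<exists>x. is_arg_min (\<lambda>x. l1_norm x / norm x) (\<lambda>x. q x \<le> 0) x"
proof -
  define c where "c = l1_norm z / norm z"
  \<comment> \<open>The quotient is discontinuous at the origin; multiplied out, the condition is visibly closed.\<close>
  define K where "K = {x :: real ^ 'n. l1_norm x \<le> c * norm x}"
  have nz: "x \<noteq> 0" if "q x \<le> 0" for x
    using that q0 by auto
  have K_iff: "x \<in> K \<longleftrightarrow> l1_norm x / norm x \<le> c" if "x \<noteq> 0" for x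
    using that by (simp add: K_def field_simps)
  have "closed K"
    unfolding K_def by (intro closed_Collect_le continuous_intros)
  have "r *\<^sub>R x \<in> K" if "x \<in> K" "0 \<le> r" for x r
    using that mult_left_mono[of "l1_norm x" "c * norm x" r]
    by (simp add: K_def l1_norm_scaleR mult.left_commute)
  moreover have "x = 0" if "x \<in> K" "A *v x = 0" for x
    using that kernel[of x] K_iff[of x] by (fastforce simp: c_def)
  ultimately obtain \<delta> where "\<delta> > 0" and \<delta>: "\<And>x. x \<in> K \<Longrightarrow> \<delta> * norm x \<le> norm (A *v x)"
    using injective_on_closed_cone_lower_bound[OF matrix_vector_mul_linear \<open>closed K\<close>] by metis
  define F where "F = K \<inter> {x. q x \<le> 0}"
  have "norm x \<le> B / \<delta>" if "x \<in> F" for x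
    using \<delta>[of x] bound[of x] that \<open>\<delta> > 0\<close> by (force simp: F_def field_simps)
  then have "bounded F"
    by (rule boundedI)
  moreover have "closed F"
    unfolding F_def using \<open>closed K\<close> cont
    by (intro closed_Int closed_Collect_le continuous_intros) auto
  ultimately have "compact F"
    by (simp add: compact_eq_bounded_closed)
  moreover have "z \<in> F"
    using K_iff[OF nz[OF feasible]] feasible by (simp add: F_def c_def)
  moreover have "continuous_on F (\<lambda>x. l1_norm x / norm x)"
    using nz by (intro continuous_intros) (auto simp: F_def)
  ultimately obtain x where "x \<in> F"
    and min: "\<And>y. y \<in> F \<Longrightarrow> l1_norm x / norm x \<le> l1_norm y / norm y"
    using continuous_attains_inf[of F "\<lambda>x. l1_norm x / norm x"] by blast
  have "l1_norm x / norm x \<le> l1_norm y / norm y" if "q y \<le> 0" for y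
  proof (cases "y \<in> K")
    case True
    with that show ?thesis by (intro min) (simp add: F_def)
  next
    case False
    then have "c < l1_norm y / norm y" using K_iff nz[OF that] by force
    with min[OF \<open>z \<in> F\<close>] show ?thesis by (simp add: c_def)
  qed
  with \<open>x \<in> F\<close> show ?thesis
    unfolding is_arg_min_def F_def by (force simp: not_less)
qed

lemma continuous_on_lorentzian_norm:
  "continuous_on S f \<Longrightarrow> continuous_on S (\<lambda>x. lorentzian_norm \<gamma> (f x))"
  unfolding lorentzian_norm_def divide_inverse
  by (intro continuous_intros ballI less_imp_neq[symmetric] add_pos_nonneg) simp_all

lemma lorentzian_norm_minus: "lorentzian_norm \<gamma> (- y) = lorentzian_norm \<gamma> y"
  by (simp add: lorentzian_norm_def)

text \<open>
  The logarithm grows slowly but is unbounded, and all summands are nonnegative, so a bound on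
  the sum bounds each coordinate.
\<close>

lemma norm_le_of_lorentzian_norm_le:
  fixes y :: "real ^ 'm"
  assumes "\<gamma> > 0" "lorentzian_norm \<gamma> y \<le> \<sigma>"
  shows "norm y \<le> real CARD('m) * (\<gamma> * sqrt (exp \<sigma>))"
proof -
  have "\<bar>y $ i\<bar> \<le> \<gamma> * sqrt (exp \<sigma>)" for i
  proof -
    have "ln (1 + (y $ i)\<^sup>2 / \<gamma>\<^sup>2) \<le> lorentzian_norm \<gamma> y"
      unfolding lorentzian_norm_def
      by (rule member_le_sum[where f = "\<lambda>i. ln (1 + (y $ i)\<^sup>2 / \<gamma>\<^sup>2)"]) auto
    with assms(2) have "ln (1 + (y $ i)\<^sup>2 / \<gamma>\<^sup>2) \<le> \<sigma>" by linarith
    moreover have "0 < 1 + (y $ i)\<^sup>2 / \<gamma>\<^sup>2"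
      by (simp add: add_pos_nonneg)
    ultimately have "1 + (y $ i)\<^sup>2 / \<gamma>\<^sup>2 \<le> exp \<sigma>"
      by (metis exp_le_cancel_iff exp_ln)
    then have "(y $ i)\<^sup>2 / \<gamma>\<^sup>2 \<le> exp \<sigma>" by linarith
    then have "(y $ i)\<^sup>2 \<le> \<gamma>\<^sup>2 * exp \<sigma>"
      using \<open>\<gamma> > 0\<close> by (simp add: field_simps)
    then have "sqrt ((y $ i)\<^sup>2) \<le> sqrt (\<gamma>\<^sup>2 * exp \<sigma>)"
      by (rule real_sqrt_le_mono)
    then show ?thesis using \<open>\<gamma> > 0\<close> by (simp add: real_sqrt_mult)
  qed
  then have "(\<Sum>i\<in>UNIV. \<bar>y $ i\<bar>) \<le> real CARD('m) * (\<gamma> * sqrt (exp \<sigma>))"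
    by (intro sum_bounded_above) simp
  with norm_le_l1_cart[of y] show ?thesis by linarith
qed

theorem theorem5p2:
  fixes A :: "real ^ 'n ^ 'm" and b :: "real ^ 'm" and \<sigma> :: real
    and q :: "real ^ 'n \<Rightarrow> real" and s :: nat and xt :: "real ^ 'n"
  assumes full_row_rank: "rank A = CARD('m)"
    and sigma_pos: "\<sigma> > 0"
    and q_cases:
      "(q = (\<lambda>x. (norm (A *v x - b))\<^sup>2 - \<sigma>\<^sup>2) \<and> norm b > \<sigma>) \<or>
       (\<exists>\<gamma>>0. q = (\<lambda>x. lorentzian_norm \<gamma> (A *v x - b) - \<sigma>) \<and> lorentzian_norm \<gamma> b > \<sigma>)"
    and ssp: "spherical_section_property CARD('m) s {v. A *v v = 0}"
    and sparse: "real (l0_norm xt) < real CARD('m) / real s"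
    and feasible: "q xt \<le> 0"
  shows "\<exists>x. is_arg_min (\<lambda>x. l1_norm x / norm x) (\<lambda>x. q x \<le> 0) x"
proof -
  have residual_cont: "continuous_on UNIV (\<lambda>x. A *v x - b)"
    by (intro continuous_intros matrix_vector_mult_linear_continuous_on)
  have "\<exists>B. continuous_on UNIV q \<and> q 0 > 0 \<and> (\<forall>x. q x \<le> 0 \<longrightarrow> norm (A *v x - b) \<le> B)"
    using q_cases
  proof (elim disjE exE conjE)
    assume q: "q = (\<lambda>x. (norm (A *v x - b))\<^sup>2 - \<sigma>\<^sup>2)" and "norm b > \<sigma>"
    have "continuous_on UNIV q"
      unfolding q by (intro continuous_intros residual_cont)
    moreover have "q 0 > 0"
      using \<open>norm b > \<sigma>\<close> sigma_pos by (simp add: q power_strict_mono)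
    moreover have "norm (A *v x - b) \<le> \<sigma>" if "q x \<le> 0" for x
      by (rule power2_le_imp_le) (use that sigma_pos in \<open>simp_all add: q\<close>)
    ultimately show ?thesis by blast
  next
    fix \<gamma> :: real
    assume "\<gamma> > 0" and q: "q = (\<lambda>x. lorentzian_norm \<gamma> (A *v x - b) - \<sigma>)"
      and "lorentzian_norm \<gamma> b > \<sigma>"
    have "continuous_on UNIV q"
      unfolding q by (intro continuous_intros continuous_on_lorentzian_norm residual_cont)
    moreover have "q 0 > 0"
      using \<open>lorentzian_norm \<gamma> b > \<sigma>\<close> by (simp add: q lorentzian_norm_minus)
    ultimately show ?thesis
      using norm_le_of_lorentzian_norm_le[OF \<open>\<gamma> > 0\<close>, of _ \<sigma>]
      by (auto simp: q)
  qed
  then obtain B where cont: "continuous_on UNIV q" and "q 0 > 0"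
    and B: "\<And>x. q x \<le> 0 \<Longrightarrow> norm (A *v x - b) \<le> B"
    by blast
  show ?thesis
  proof (rule ratio_attains_min[OF cont \<open>q 0 > 0\<close> _ feasible])
    show "norm (A *v x) \<le> B + norm b" if "q x \<le> 0" for x
      using B[OF that] norm_triangle_sub[of "A *v x" b] by linarith
    have "xt \<noteq> 0"
      using feasible \<open>q 0 > 0\<close> by auto
    then have "l1_norm xt / norm xt \<le> sqrt (real (l0_norm xt))"
      using l1_norm_le_sqrt_l0_norm[of xt] by (simp add: field_simps)
    also have "\<dots> < sqrt (real CARD('m) / real s)"
      using sparse by simp
    finally show "l1_norm xt / norm xt < l1_norm v / norm v" if "A *v v = 0" "v \<noteq> 0" for v
      using spherical_section_property_lower_bound[OF ssp, of v] that by simp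
  qed
qed

end
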